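(* Let $\ell\geq 2$ be an integer and let $1\le m\leq n$ be integers. Then $$pc_{1,\ell}(K_{m,n})=\begin{cases} n & \text{if } m=1,\\ 2 & \text{if } m\geq 2 \text{ and } m\leq n\leq 2^m,\\ 3 & \text{if } \ell=2,\ m\geq 2 \text{ and } n>2^m, \text{ or if } \ell\geq 3,\ m\geq 2 \text{ and } 2^m<n\leq 3^m,\\ 4 & \text{if } \ell\geq 3,\ m\geq 2 \text{ and } n>3^m.\end{cases}$$
   Context: $K_{m,n}$ is the complete bipartite graph with parts of sizes $m$ and $n$. An edge-coloring of a graph is an arbitrary map from its edge set to the natural numbers (adjacent edges may share a color). In an edge-colored graph, a path $P$ is a distance $\ell$-proper path if no two edges of $P$ of the same color appear with fewer than $\ell$ edges in between on $P$. For a connected graph $G$, $pc_{1,\ell}(G)$ is the minimum number of colors in an edge-coloring of $G$ such that every pair of distinct vertices of $G$ is connected by at least one distance $\ell$-proper path. *)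

theory Defs
  imports Main
begin

text \<open>Undirected simple graphs, given by a vertex set and a set of two-element sets of vertices.\<close>

type_synonym 'a graph = "'a set \<times> 'a set set"

abbreviation verts :: "'a graph \<Rightarrow> 'a set" where
  "verts G \<equiv> fst G"

abbreviation edges :: "'a graph \<Rightarrow> 'a set set" where
  "edges G \<equiv> snd G"

definition complete_bipartite :: "nat \<Rightarrow> nat \<Rightarrow> (nat + nat) graph" where
  "complete_bipartite m n =
     (Inl ` {..<m} \<union> Inr ` {..<n}, {{Inl i, Inr j} | i j. i < m \<and> j < n})"

text \<open>A path is represented by the list of its vertices, in order.\<close>

definition path_edges :: "'a list \<Rightarrow> 'a set list" where
  "path_edges xs = map (\<lambda>i. {xs ! i, xs ! Suc i}) [0..<length xs - 1]"

definition is_path :: "'a graph \<Rightarrow> 'a list \<Rightarrow> bool" where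
  "is_path G xs \<longleftrightarrow>
     xs \<noteq> [] \<and> distinct xs \<and> set xs \<subseteq> verts G \<and> set (path_edges xs) \<subseteq> edges G"

text \<open>The \<open>i\<close>-th and \<open>j\<close>-th edges of a path, \<open>i < j\<close>, have \<open>j - i - 1\<close> edges in between.\<close>

definition distance_proper_path ::
    "nat \<Rightarrow> 'a graph \<Rightarrow> ('a set \<Rightarrow> nat) \<Rightarrow> 'a list \<Rightarrow> bool" where
  "distance_proper_path l G c xs \<longleftrightarrow> is_path G xs \<and>
     (\<forall>i j. i < j \<longrightarrow> j < length (path_edges xs) \<longrightarrow>
        c (path_edges xs ! i) = c (path_edges xs ! j) \<longrightarrow> j - i - 1 \<ge> l)"

definition distance_proper_connected ::
    "nat \<Rightarrow> 'a graph \<Rightarrow> ('a set \<Rightarrow> nat) \<Rightarrow> bool" where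
  "distance_proper_connected l G c \<longleftrightarrow>
     (\<forall>u \<in> verts G. \<forall>v \<in> verts G. u \<noteq> v \<longrightarrow>
        (\<exists>xs. distance_proper_path l G c xs \<and> hd xs = u \<and> last xs = v))"

text \<open>
  An edge-coloring is a function on all vertex sets, but only its values on edges matter: paths
  use edges only, and the colors counted are those used on edges. The number is meaningful for
  finite connected graphs, where coloring the edges injectively shows that the minimum exists.
\<close>

definition pc1 :: "nat \<Rightarrow> 'a graph \<Rightarrow> nat" where
  "pc1 l G = (LEAST k. \<exists>c. distance_proper_connected l G c \<and> card (c ` edges G) = k)"

end

theory Submission
  imports Defs "HOL-Library.FuncSet"
begin

text \<open>
  A coloring assigns to each vertex of the part of size \<open>n\<close> the vector of the \<open>m\<close> colors at its
  edges. With at most \<open>min 3 l\<close> colors a distance \<open>l\<close>-proper path has at most three edges, so by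
  parity two vertices of that part can only be joined through a common neighbor, which forces
  their vectors to differ; hence \<open>k\<close> colors only allow \<open>n \<le> k ^ m\<close>. Conversely, distinct vectors
  that include the unit vectors connect both parts by paths of length two.
  Beyond that range, all but \<open>m\<close> of the vertices share one vector, and two of these are joined
  by a path of length four, whose colors are \<open>0, 1, 2, 0\<close> if \<open>l = 2\<close> and \<open>0, 1, 2, 3\<close> if \<open>l \<ge> 3\<close>.
\<close>

section \<open>Edges and vertices of \<open>complete_bipartite\<close>, and edge lists of
  paths\<close>

lemma edges_complete_bipartite:
  "edges (complete_bipartite m n) = {{Inl i, Inr j} | i j. i < m \<and> j < n}"
  by (simp add: complete_bipartite_def)

lemma verts_complete_bipartite:
  "verts (complete_bipartite m n) = Inl ` {..<m} \<union> Inr ` {..<n}"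
  by (simp add: complete_bipartite_def)

lemma edge_in_complete_bipartite [simp]:
  "{Inl i, Inr j} \<in> edges (complete_bipartite m n) \<longleftrightarrow> i < m \<and> j < n"
  "{Inr j, Inl i} \<in> edges (complete_bipartite m n) \<longleftrightarrow> i < m \<and> j < n"
  "{Inl i, Inl i'} \<notin> edges (complete_bipartite m n)"
  "{Inr j, Inr j'} \<notin> edges (complete_bipartite m n)"
  by (auto simp: edges_complete_bipartite doubleton_eq_iff)

lemma vert_in_complete_bipartite [simp]:
  "Inl i \<in> verts (complete_bipartite m n) \<longleftrightarrow> i < m"
  "Inr j \<in> verts (complete_bipartite m n) \<longleftrightarrow> j < n"
  by (auto simp: verts_complete_bipartite)

lemma finite_edges_complete_bipartite: "finite (edges (complete_bipartite m n))"
proof -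
  have "edges (complete_bipartite m n) = (\<lambda>(i, j). {Inl i, Inr j}) ` ({..<m} \<times> {..<n})"
    by (auto simp: edges_complete_bipartite)
  then show ?thesis
    by (metis finite_cartesian_product finite_imageI finite_lessThan)
qed

lemma path_edges_simps [simp]:
  "path_edges [] = []"
  "path_edges [x] = []"
  "path_edges (x # y # zs) = {x, y} # path_edges (y # zs)"
proof -
  show "path_edges (x # y # zs) = {x, y} # path_edges (y # zs)"
    by (rule nth_equalityI) (auto simp: path_edges_def nth_Cons simp del: upt_Suc split: nat.split)
qed (simp_all add: path_edges_def)

lemma length_path_edges [simp]: "length (path_edges xs) = length xs - 1"
  by (simp add: path_edges_def)

section \<open>Lower bounds: few colors force short paths and hence distinct color vectors\<close>

lemma distance_proper_pathD:
  assumes "distance_proper_path l G c xs" "i < j" "j < length xs - 1" "j - i - 1 < l"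
  shows "c (path_edges xs ! i) \<noteq> c (path_edges xs ! j)"
  using assms unfolding distance_proper_path_def by (metis length_path_edges not_le)

text \<open>Pigeonhole: among the first \<open>?k + 1\<close> edges any two have fewer than
  \<open>?k \<le> l\<close> edges in between, so their colors would all differ.\<close>

lemma distance_proper_path_length_le:
  assumes "distance_proper_path l G c xs" "finite (edges G)" "card (c ` edges G) \<le> l"
  shows "length xs \<le> card (c ` edges G) + 1"
proof (rule ccontr)
  let ?k = "card (c ` edges G)"
  assume "\<not> ?thesis"
  then have len: "?k < length xs - 1"
    by simp
  have "inj_on (\<lambda>i. c (path_edges xs ! i)) {..?k}"
  proof (rule linorder_inj_onI)
    fix i j assume "i < j" "i \<in> {..?k}" "j \<in> {..?k}"
    with len assms(3) show "c (path_edges xs ! i) \<noteq> c (path_edges xs ! j)"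
      by (intro distance_proper_pathD [OF assms(1)]) auto
  qed linarith
  moreover have "(\<lambda>i. c (path_edges xs ! i)) ` {..?k} \<subseteq> c ` edges G"
  proof -
    have "path_edges xs ! i \<in> edges G" if "i \<le> ?k" for i
    proof -
      have "path_edges xs ! i \<in> set (path_edges xs)"
        using that len by (intro nth_mem) simp
      then show ?thesis
        using assms(1) by (auto simp: distance_proper_path_def is_path_def)
    qed
    then show ?thesis
      by auto
  qed
  ultimately have "card {..?k} \<le> ?k"
    by (rule card_inj_on_le) (simp add: assms(2))
  then show False
    by simp
qed

text \<open>At most three edges between two vertices of the same side means, by parity, exactly two;
  these are adjacent, so \<open>l \<ge> 1\<close> makes their colors differ at the common
  neighbor.\<close>

lemma short_path_colors_differ:
  assumes path: "distance_proper_path l (complete_bipartite m n) c xs"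
    and "l \<ge> 1" "hd xs = Inr j" "last xs = Inr j'" "j \<noteq> j'" "length xs \<le> 4"
  obtains i where "i < m" "c {Inl i, Inr j} \<noteq> c {Inl i, Inr j'}"
proof -
  have "is_path (complete_bipartite m n) xs"
    using path by (simp add: distance_proper_path_def)
  then have ne: "xs \<noteq> []" and sub: "set (path_edges xs) \<subseteq> edges (complete_bipartite m n)"
    by (auto simp: is_path_def)
  from \<open>length xs \<le> 4\<close> ne consider a where "xs = [a]" | a b where "xs = [a, b]"
    | a b d where "xs = [a, b, d]" | a b d e where "xs = [a, b, d, e]"
    by (auto simp: le_Suc_eq numeral_eq_Suc length_Suc_conv)
  then show thesis
  proof cases
    case 1
    with assms show ?thesis by simp
  next
    case 2
    with assms sub show ?thesis by simp
  next
    case 3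
    with assms(3,4) sub obtain i where i: "i < m" "xs = [Inr j, Inl i, Inr j']"
      by (cases b) auto
    have "c {Inl i, Inr j} \<noteq> c {Inl i, Inr j'}"
      using distance_proper_pathD [OF path, of 0 1] i \<open>l \<ge> 1\<close> by (simp add: insert_commute)
    with i that show ?thesis by blast
  next
    case 4
    with assms(3,4) sub show ?thesis by (cases b; cases d) auto
  qed
qed

lemma distinct_color_vectors_bound:
  assumes "\<And>j j'. j < n \<Longrightarrow> j' < n \<Longrightarrow> j \<noteq> j' \<Longrightarrow>
    \<exists>i < m. c {Inl i, Inr j} \<noteq> c {Inl i, Inr j'}"
  shows "n \<le> card (c ` edges (complete_bipartite m n)) ^ m"
proof -
  let ?C = "c ` edges (complete_bipartite m n)"
  \<comment> \<open>Restricting each vector to \<open>{..<m}\<close> places it in an extensional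
    function space, which is finite and has \<open>card ?C ^ m\<close> elements.\<close>
  let ?v = "\<lambda>j. \<lambda>i \<in> {..<m}. c {Inl i, Inr j}"
  have "inj_on ?v {..<n}"
  proof (rule inj_onI, rule ccontr)
    fix j j' assume *: "j \<in> {..<n}" "j' \<in> {..<n}" "?v j = ?v j'" "j \<noteq> j'"
    then obtain i where "i < m" "c {Inl i, Inr j} \<noteq> c {Inl i, Inr j'}"
      using assms by blast
    with fun_cong [OF *(3), of i] show False by simp
  qed
  moreover have "?v ` {..<n} \<subseteq> {..<m} \<rightarrow>\<^sub>E ?C"
    by (auto split: if_splits)
  moreover have "finite ({..<m} \<rightarrow>\<^sub>E ?C)"
    by (simp add: finite_PiE finite_edges_complete_bipartite)
  ultimately have "card {..<n} \<le> card ({..<m} \<rightarrow>\<^sub>E ?C)"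
    by (rule card_inj_on_le)
  then show ?thesis
    by (simp add: card_PiE)
qed

text \<open>The hypothesis \<open>k \<le> l\<close> bounds a path by \<open>k\<close> edges, and
  \<open>k \<le> 3\<close> brings this into the range of the parity argument.\<close>

lemma few_colors_bound:
  fixes c :: "(nat + nat) set \<Rightarrow> nat" and m n :: nat
  defines "k \<equiv> card (c ` edges (complete_bipartite m n))"
  assumes conn: "distance_proper_connected l (complete_bipartite m n) c"
    and "l \<ge> 1" "k \<le> l" "k \<le> 3"
  shows "n \<le> k ^ m"
  unfolding k_def
proof (rule distinct_color_vectors_bound)
  fix j j' assume j: "j < n" "j' < n" "j \<noteq> j'"
  then obtain xs where xs: "distance_proper_path l (complete_bipartite m n) c xs"
      "hd xs = Inr j" "last xs = Inr j'"
    using conn unfolding distance_proper_connected_def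
    by (metis sum.inject(2) vert_in_complete_bipartite(2))
  have "length xs \<le> k + 1"
    using distance_proper_path_length_le [OF xs(1) finite_edges_complete_bipartite] \<open>k \<le> l\<close>
    by (simp add: k_def)
  with \<open>k \<le> 3\<close> have "length xs \<le> 4"
    by simp
  then show "\<exists>i < m. c {Inl i, Inr j} \<noteq> c {Inl i, Inr j'}"
    using short_path_colors_differ [OF xs(1) \<open>l \<ge> 1\<close> xs(2,3) j(3)] by metis
qed

text \<open>In a star the graph itself, not the number of colors, keeps paths short. Hence the bound
  holds even when more than \<open>l\<close> or more than three colors occur.\<close>

lemma star_bound:
  assumes conn: "distance_proper_connected l (complete_bipartite 1 n) c" and "l \<ge> 1"
  shows "n \<le> card (c ` edges (complete_bipartite 1 n))"
proof -
  have "n \<le> card (c ` edges (complete_bipartite 1 n)) ^ 1"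
  proof (rule distinct_color_vectors_bound)
    fix j j' assume j: "j < n" "j' < n" "j \<noteq> j'"
    then obtain xs where xs: "distance_proper_path l (complete_bipartite 1 n) c xs"
        "hd xs = Inr j" "last xs = Inr j'"
      using conn unfolding distance_proper_connected_def
      by (metis sum.inject(2) vert_in_complete_bipartite(2))
    have "length xs \<le> 4"
    proof (rule ccontr)
      assume "\<not> ?thesis"
      then obtain x0 x1 x2 x3 ys where [simp]: "xs = x0 # x1 # x2 # x3 # ys"
        by (auto simp: not_le numeral_eq_Suc Suc_le_length_iff dest!: Suc_leI)
      have "set (path_edges xs) \<subseteq> edges (complete_bipartite 1 n)" "distinct xs"
        using xs(1) unfolding distance_proper_path_def is_path_def by blast+
      \<comment> \<open>Sides alternate from \<open>Inr j\<close> on, so \<open>x1\<close> and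
        \<open>x3\<close> would both be the only center \<open>Inl 0\<close>.\<close>
      with xs(2) show False
        by (cases x1; cases x2; cases x3) auto
    qed
    then show "\<exists>i < 1. c {Inl i, Inr j} \<noteq> c {Inl i, Inr j'}"
      using short_path_colors_differ [OF xs(1) \<open>l \<ge> 1\<close> xs(2,3) j(3)] by metis
  qed
  then show ?thesis by simp
qed

section \<open>The minimum in \<open>pc1\<close>\<close>

lemma pc1_le:
  assumes "distance_proper_connected l G c" "card (c ` edges G) \<le> k"
  shows "pc1 l G \<le> k"
proof -
  have "pc1 l G \<le> card (c ` edges G)"
    unfolding pc1_def using assms(1) by (intro Least_le) blast
  with assms(2) show ?thesis by simp
qed

text \<open>\<open>LEAST\<close> says something about its value only if a witness exists, which is
  why some connected coloring is assumed.\<close>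

lemma pc1_attained:
  assumes "distance_proper_connected l G c"
  obtains c' where "distance_proper_connected l G c'" "card (c' ` edges G) = pc1 l G"
proof -
  have "\<exists>c'. distance_proper_connected l G c' \<and> card (c' ` edges G) = pc1 l G"
    unfolding pc1_def by (rule LeastI_ex) (use assms in blast)
  with that show thesis by blast
qed

section \<open>Upper bounds: colorings given by matrices\<close>

definition bipartite_coloring :: "(nat \<Rightarrow> nat \<Rightarrow> nat) \<Rightarrow> (nat + nat) set \<Rightarrow> nat" where
  "bipartite_coloring f e = f (the_elem (Inl -` e)) (the_elem (Inr -` e))"

lemma bipartite_coloring_simps [simp]:
  "bipartite_coloring f {Inl i, Inr j} = f i j"
  "bipartite_coloring f {Inr j, Inl i} = f i j"
proof -
  have "Inl -` {Inl i, Inr j} = {i}" "Inr -` {Inl i, Inr j} = {j}"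
    by auto
  then show "bipartite_coloring f {Inl i, Inr j} = f i j"
    by (simp add: bipartite_coloring_def)
  then show "bipartite_coloring f {Inr j, Inl i} = f i j"
    by (simp add: insert_commute)
qed

lemma card_bipartite_coloring_le:
  assumes "\<And>i j. i < m \<Longrightarrow> j < n \<Longrightarrow> f i j < k"
  shows "card (bipartite_coloring f ` edges (complete_bipartite m n)) \<le> k"
proof -
  have "bipartite_coloring f ` edges (complete_bipartite m n) \<subseteq> {..<k}"
    using assms by (auto simp: edges_complete_bipartite)
  from card_mono [OF _ this] show ?thesis
    by simp
qed

text \<open>Vertices on opposite sides are adjacent, and two rows or columns that differ somewhere
  yield a path of length two. The alternative in \<open>right\<close> allows for repeated
  columns.\<close>

lemma distance_proper_connected_bipartite_coloring:
  assumes "m \<ge> 1" "n \<ge> 1"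
    and left: "\<And>i i'. i < m \<Longrightarrow> i' < m \<Longrightarrow> i \<noteq> i' \<Longrightarrow> \<exists>j < n. f i j \<noteq> f i' j"
    and right: "\<And>j j'. j < n \<Longrightarrow> j' < n \<Longrightarrow> j \<noteq> j' \<Longrightarrow> (\<exists>i < m. f i j \<noteq> f i j') \<or>
      (\<exists>xs. distance_proper_path l (complete_bipartite m n) (bipartite_coloring f) xs \<and>
        hd xs = Inr j \<and> last xs = Inr j')"
  shows "distance_proper_connected l (complete_bipartite m n) (bipartite_coloring f)"
proof -
  let ?G = "complete_bipartite m n"
  let ?P = "\<lambda>u v. \<exists>xs. distance_proper_path l ?G (bipartite_coloring f) xs \<and>
    hd xs = u \<and> last xs = v"
  have "?P u v" if u: "u \<in> verts ?G" and v: "v \<in> verts ?G" and neq: "u \<noteq> v" for u v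
  proof (cases u; cases v)
    fix i i' assume [simp]: "u = Inl i" "v = Inl i'"
    then obtain j where "j < n" "f i j \<noteq> f i' j"
      using left [of i i'] u v neq by auto
    then have "distance_proper_path l ?G (bipartite_coloring f) [Inl i, Inr j, Inl i']"
      using u v neq by (auto simp: distance_proper_path_def is_path_def less_Suc_eq)
    then show ?thesis by force
  next
    fix i j assume [simp]: "u = Inl i" "v = Inr j"
    have "distance_proper_path l ?G (bipartite_coloring f) [Inl i, Inr j]"
      using u v neq by (auto simp: distance_proper_path_def is_path_def)
    then show ?thesis by force
  next
    fix i j assume [simp]: "u = Inr j" "v = Inl i"
    have "distance_proper_path l ?G (bipartite_coloring f) [Inr j, Inl i]"
      using u v neq by (auto simp: distance_proper_path_def is_path_def)
    then show ?thesis by force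
  next
    fix j j' assume [simp]: "u = Inr j" "v = Inr j'"
    from right [of j j'] u v neq consider i where "i < m" "f i j \<noteq> f i j'" | "?P u v"
      by auto
    then show ?thesis
    proof cases
      case 1
      then have "distance_proper_path l ?G (bipartite_coloring f) [Inr j, Inl i, Inr j']"
        using u v neq by (auto simp: distance_proper_path_def is_path_def less_Suc_eq)
      then show ?thesis by force
    qed
  qed
  then show ?thesis
    by (simp add: distance_proper_connected_def)
qed

text \<open>The columns are \<open>n\<close> of the \<open>k ^ m\<close> vectors, chosen to include
  all \<open>m\<close> unit vectors: distinctness separates the columns, the unit vectors separate
  the rows. The bound \<open>k \<ge> 2\<close> admits the entries 0 and 1.\<close>

lemma distinct_color_vectors_exist:
  fixes k m n :: nat
  assumes "k \<ge> 2" "m \<le> n" "n \<le> k ^ m"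
  obtains f :: "nat \<Rightarrow> nat \<Rightarrow> nat"
  where "\<And>i j. i < m \<Longrightarrow> j < n \<Longrightarrow> f i j < k"
    and "\<And>i i'. i < m \<Longrightarrow> i' < m \<Longrightarrow> i \<noteq> i' \<Longrightarrow> \<exists>j < n. f i j \<noteq> f i' j"
    and "\<And>j j'. j < n \<Longrightarrow> j' < n \<Longrightarrow> j \<noteq> j' \<Longrightarrow> \<exists>i < m. f i j \<noteq> f i j'"
proof -
  define unit :: "nat \<Rightarrow> nat \<Rightarrow> nat" where "unit a = (\<lambda>i \<in> {..<m}. of_bool (i = a))" for a
  let ?V = "{..<m} \<rightarrow>\<^sub>E {..<k}"
  have unit_eq: "unit a i = of_bool (i = a)" if "i < m" for a i
    using that by (simp add: unit_def)
  have "inj_on unit {..<m}"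
    by (rule inj_onI) (metis lessThan_iff of_bool_eq_iff unit_eq)
  then have "card (unit ` {..<m}) = m"
    by (simp add: card_image)
  moreover have "unit ` {..<m} \<subseteq> ?V"
    using \<open>k \<ge> 2\<close> by (auto simp: unit_def split: if_splits)
  moreover have "finite ?V"
    by (simp add: finite_PiE)
  moreover have "card ?V = k ^ m"
    by (simp add: card_PiE)
  ultimately obtain S where S: "unit ` {..<m} \<subseteq> S" "S \<subseteq> ?V" "card S = n"
    using exists_subset_between [of "unit ` {..<m}" n ?V] assms by auto
  have "finite S"
    using S(2) \<open>finite ?V\<close> finite_subset by blast
  then obtain h where h: "bij_betw h {..<n} S"
    using ex_bij_betw_nat_finite [of S] S(3) by (auto simp: atLeast0LessThan)
  have hV: "h j \<in> ?V" if "j < n" for j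
    using h S(2) that by (auto dest: bij_betwE)
  show thesis
  proof (rule that [of "\<lambda>i j. h j i"])
    show "h j i < k" if "i < m" "j < n" for i j
      using hV [OF that(2)] that(1) by (auto simp: PiE_iff)
    show "\<exists>j < n. h j i \<noteq> h j i'" if i: "i < m" "i' < m" "i \<noteq> i'" for i i'
    proof -
      \<comment> \<open>The column holding the unit vector of \<open>i\<close> tells row
        \<open>i\<close> from row \<open>i'\<close>.\<close>
      have "unit i \<in> h ` {..<n}"
        using h S(1) i(1) by (auto simp: bij_betw_def)
      then obtain j where "j < n" "h j = unit i"
        by auto
      with i have "h j i = 1" "h j i' = 0"
        by (auto simp: unit_eq)
      with \<open>j < n\<close> show ?thesis
        by force
    qed
    show "\<exists>i < m. h j i \<noteq> h j' i" if j: "j < n" "j' < n" "j \<noteq> j'" for j j'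
    proof (rule ccontr)
      assume "\<not> ?thesis"
      then have "h j = h j'"
        using hV [OF j(1)] hV [OF j(2)] by (intro PiE_ext) auto
      with h j show False
        by (auto simp: bij_betw_def inj_on_def)
    qed
  qed
qed

lemma vector_coloring_exists:
  assumes "k \<ge> 2" "1 \<le> m" "m \<le> n" "n \<le> k ^ m"
  obtains c where "distance_proper_connected l (complete_bipartite m n) c"
    "card (c ` edges (complete_bipartite m n)) \<le> k"
proof -
  obtain f :: "nat \<Rightarrow> nat \<Rightarrow> nat"
    where f: "\<And>i j. i < m \<Longrightarrow> j < n \<Longrightarrow> f i j < k"
      "\<And>i i'. i < m \<Longrightarrow> i' < m \<Longrightarrow> i \<noteq> i' \<Longrightarrow> \<exists>j < n. f i j \<noteq> f i' j"
      "\<And>j j'. j < n \<Longrightarrow> j' < n \<Longrightarrow> j \<noteq> j' \<Longrightarrow> \<exists>i < m. f i j \<noteq> f i j'"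
    using distinct_color_vectors_exist [OF assms(1,3,4)] by blast
  show thesis
  proof (rule that)
    show "distance_proper_connected l (complete_bipartite m n) (bipartite_coloring f)"
      using assms f by (intro distance_proper_connected_bipartite_coloring) auto
    show "card (bipartite_coloring f ` edges (complete_bipartite m n)) \<le> k"
      using f(1) by (rule card_bipartite_coloring_le)
  qed
qed

text \<open>
  For \<open>j \<ge> m\<close> all vectors are equal to \<open>(0, e, 0, \<dots>, 0)\<close>; such vertices are joined by the path
  \<open>Inr j, Inl 0, Inr 0, Inl 1, Inr j'\<close> with colors \<open>0, 1, 2, e\<close>.
\<close>

lemma repeated_vector_coloring_exists:
  assumes "2 \<le> m" "m \<le> n" "(l \<le> 2 \<and> e = 0) \<or> e = 3"
  obtains c where "distance_proper_connected l (complete_bipartite m n) c"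
    "card (c ` edges (complete_bipartite m n)) \<le> max 3 (Suc e)"
proof -
  define f :: "nat \<Rightarrow> nat \<Rightarrow> nat" where
    "f i j = (if i = j then 1 else if i = 1 \<and> j = 0 then 2 else if i = 1 \<and> j \<ge> m then e else 0)"
    for i j
  have e1: "e \<noteq> 1"
    using assms(3) by auto
  show thesis
  proof (rule that)
    show "distance_proper_connected l (complete_bipartite m n) (bipartite_coloring f)"
    proof (rule distance_proper_connected_bipartite_coloring)
      show "\<exists>j < n. f i j \<noteq> f i' j" if "i < m" "i' < m" "i \<noteq> i'" for i i'
        \<comment> \<open>The color 1 occurs only on the diagonal, as \<open>e \<noteq> 1\<close>;
          so column \<open>i\<close> separates row \<open>i\<close> from every other row.\<close>
        using that assms(2) e1 by (intro exI [of _ i]) (auto simp: f_def)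
      show "(\<exists>i < m. f i j \<noteq> f i j') \<or>
        (\<exists>xs. distance_proper_path l (complete_bipartite m n) (bipartite_coloring f) xs \<and>
          hd xs = Inr j \<and> last xs = Inr j')" if j: "j < n" "j' < n" "j \<noteq> j'" for j j'
      proof -
        consider "j < m" | "j' < m" | "j \<ge> m" "j' \<ge> m"
          by linarith
        then show ?thesis
        proof cases
          case 1
          then show ?thesis
            \<comment> \<open>Since \<open>j < m\<close>, row \<open>j\<close> exists and has its
              only 1 in column \<open>j\<close>.\<close>
            using j e1 by (intro disjI1 exI [of _ j]) (auto simp: f_def)
        next
          case 2
          then show ?thesis
            using j e1 by (intro disjI1 exI [of _ j']) (auto simp: f_def)
        next
          case 3
          then have "f 0 j = 0" "f 0 0 = 1" "f 1 0 = 2" "f 1 j' = e"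
            using assms(1) by (auto simp: f_def)
          \<comment> \<open>If \<open>e = 0\<close>, the first and last edges share a color but have
            two edges in between, enough for \<open>l \<le> 2\<close>; if \<open>e = 3\<close>, all
            four colors differ.\<close>
          then have "distance_proper_path l (complete_bipartite m n) (bipartite_coloring f)
              [Inr j, Inl 0, Inr 0, Inl 1, Inr j']"
            using 3 j assms by (auto simp: distance_proper_path_def is_path_def less_Suc_eq)
          then show ?thesis
            by (intro disjI2) force
        qed
      qed
    qed (use assms in auto)
    show "card (bipartite_coloring f ` edges (complete_bipartite m n)) \<le> max 3 (Suc e)"
      by (rule card_bipartite_coloring_le) (auto simp: f_def)
  qed
qed

section \<open>Exact values of \<open>pc1\<close>\<close>

lemma pc1_lower_bound:
  assumes "distance_proper_connected l (complete_bipartite m n) c"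
    and "1 \<le> l" "k \<le> l" "k \<le> 3" "k ^ m < n"
  shows "k < pc1 l (complete_bipartite m n)"
proof (rule ccontr)
  let ?p = "pc1 l (complete_bipartite m n)"
  obtain c' where c': "distance_proper_connected l (complete_bipartite m n) c'"
      "card (c' ` edges (complete_bipartite m n)) = ?p"
    using pc1_attained [OF assms(1)] .
  assume "\<not> k < ?p"
  then have "?p \<le> k" by simp
  \<comment> \<open>A coloring attaining the minimum uses \<open>?p \<le> k\<close> colors and so
    inherits the bounds by \<open>l\<close> and 3.\<close>
  have "n \<le> ?p ^ m"
    using few_colors_bound [OF c'(1) \<open>1 \<le> l\<close>] c'(2) \<open>?p \<le> k\<close> assms(3,4) by simp
  also have "\<dots> \<le> k ^ m"
    using \<open>?p \<le> k\<close> by (rule power_mono) simp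
  finally show False
    using \<open>k ^ m < n\<close> by simp
qed

lemma pc1_eq_Suc:
  assumes "distance_proper_connected l (complete_bipartite m n) c"
    and "card (c ` edges (complete_bipartite m n)) \<le> Suc k"
    and "1 \<le> l" "k \<le> l" "k \<le> 3" "k ^ m < n"
  shows "pc1 l (complete_bipartite m n) = Suc k"
  using pc1_le [OF assms(1,2)] pc1_lower_bound [OF assms(1,3-6)] by simp

lemma pc1_star:
  assumes "l \<ge> 1" "n \<ge> 1"
  shows "pc1 l (complete_bipartite 1 n) = n"
proof -
  \<comment> \<open>All edges of the star get different colors.\<close>
  let ?c = "bipartite_coloring (\<lambda>i j. j)"
  have conn: "distance_proper_connected l (complete_bipartite 1 n) ?c"
    by (rule distance_proper_connected_bipartite_coloring) (use assms in auto)
  have "card (?c ` edges (complete_bipartite 1 n)) \<le> n"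
    by (rule card_bipartite_coloring_le)
  then have "pc1 l (complete_bipartite 1 n) \<le> n"
    by (rule pc1_le [OF conn])
  moreover have "n \<le> pc1 l (complete_bipartite 1 n)"
    using pc1_attained [OF conn] star_bound \<open>l \<ge> 1\<close> by metis
  ultimately show ?thesis by simp
qed

theorem theorem2p7:
  fixes l m n :: nat
  assumes "l \<ge> 2" and "1 \<le> m" and "m \<le> n"
  shows "(m = 1 \<longrightarrow> pc1 l (complete_bipartite m n) = n) \<and>
    (m \<ge> 2 \<and> m \<le> n \<and> n \<le> 2 ^ m \<longrightarrow> pc1 l (complete_bipartite m n) = 2) \<and>
    ((l = 2 \<and> m \<ge> 2 \<and> n > 2 ^ m) \<or> (l \<ge> 3 \<and> m \<ge> 2 \<and> 2 ^ m < n \<and> n \<le> 3 ^ m)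
       \<longrightarrow> pc1 l (complete_bipartite m n) = 3) \<and>
    (l \<ge> 3 \<and> m \<ge> 2 \<and> n > 3 ^ m \<longrightarrow> pc1 l (complete_bipartite m n) = 4)"
proof (intro conjI impI)
  assume "m = 1"
  with assms show "pc1 l (complete_bipartite m n) = n"
    using pc1_star [of l n] by simp
next
  assume *: "m \<ge> 2 \<and> m \<le> n \<and> n \<le> 2 ^ m"
  obtain c where "distance_proper_connected l (complete_bipartite m n) c"
      "card (c ` edges (complete_bipartite m n)) \<le> 2"
    using vector_coloring_exists [of 2 m n l] assms * by auto
  \<comment> \<open>With \<open>k = 1\<close> the lower bound only needs
    \<open>1 ^ m = 1 < n\<close>, true because \<open>n \<ge> m \<ge> 2\<close>.\<close>
  then show "pc1 l (complete_bipartite m n) = 2"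
    using pc1_eq_Suc [of l m n c 1] assms * by (simp add: numeral_2_eq_2)
next
  assume *: "(l = 2 \<and> m \<ge> 2 \<and> n > 2 ^ m) \<or> (l \<ge> 3 \<and> m \<ge> 2 \<and> 2 ^ m < n \<and> n \<le> 3 ^ m)"
  then obtain c where "distance_proper_connected l (complete_bipartite m n) c"
      "card (c ` edges (complete_bipartite m n)) \<le> 3"
    \<comment> \<open>Distinct vectors over three colors serve \<open>n \<le> 3 ^ m\<close>; for
      \<open>l = 2\<close> and any \<open>n\<close>, the repeated vector with \<open>e = 0\<close>
      needs no fourth color.\<close>
    using vector_coloring_exists [of 3 m n l] repeated_vector_coloring_exists [of m n l 0] assms
    by auto
  then show "pc1 l (complete_bipartite m n) = 3"
    using pc1_eq_Suc [of l m n c 2] assms * by auto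
next
  assume *: "l \<ge> 3 \<and> m \<ge> 2 \<and> n > 3 ^ m"
  then obtain c where "distance_proper_connected l (complete_bipartite m n) c"
      "card (c ` edges (complete_bipartite m n)) \<le> 4"
    using repeated_vector_coloring_exists [of m n l 3] assms by auto
  \<comment> \<open>The lower bound with \<open>k = 3\<close> is where \<open>l \<ge> 3\<close>
    enters.\<close>
  then show "pc1 l (complete_bipartite m n) = 4"
    using pc1_eq_Suc [of l m n c 3] assms * by auto
qed

end
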